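(* Let $m$ be an integer with $m\ge 6$ or $m=4$. (a) There exist vectors $v_1,\ldots,v_m\in S^2$ with $\sum_{i=1}^m v_i=0$ which minimize the function $$P(w_1,\ldots,w_m)=\sum_{1\le i,j\le m}\langle w_i,w_j\rangle_{\mathbb R}^2$$ over all $(w_1,\ldots,w_m)\in (S^2)^m$. (b) $$M^4(m,2)=\frac{m(m-3)}{6}.$$
   Context: $S^2$ is the unit sphere in $\mathbb R^3$ and $\langle\cdot,\cdot\rangle_{\mathbb R}$ is the standard real inner product. The minimum in (a) is the minimum over all of $(S^2)^m$ (not only over tuples with zero sum). On $\mathbb C^n$ use the standard Hermitian inner product $\langle v,w\rangle=\sum_{i} v_i\overline{w_i}$ and norm $\|v\|=\langle v,v\rangle^{1/2}$. For positive integers $m,n,p$, $$M^p(m,n)=\min\Big\{\sum_{1\le i<j\le m}|\langle v_i,v_j\rangle|^p \;:\; v_1,\ldots,v_m\in\mathbb C^n,\ \|v_l\|=1 \text{ for all } 1\le l\le m\Big\}.$$ *)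

theory Defs
  imports "HOL-Analysis.Analysis"
begin

(* The library's inner product on complex^'n is the real one, so the Hermitian product
   (linear in the first argument) is defined here.  The library norm on complex^'n agrees
   with the norm it induces, see norm_eq_sqrt_hermitian. *)

definition hermitian :: "complex ^ 'n \<Rightarrow> complex ^ 'n \<Rightarrow> complex"
  where "hermitian v w = (\<Sum>i\<in>UNIV. v $ i * cnj (w $ i))"

lemma norm_eq_sqrt_hermitian:
  fixes v :: "complex ^ 'n"
  shows "hermitian v v = complex_of_real ((norm v)\<^sup>2)"
    and "norm v = sqrt (Re (hermitian v v))"
proof -
  show *: "hermitian v v = complex_of_real ((norm v)\<^sup>2)"
    by (simp add: hermitian_def norm_vec_def L2_set_def sum_nonneg complex_norm_square
        del: of_real_power)
  show "norm v = sqrt (Re (hermitian v v))"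
    unfolding * by simp
qed

(* A family v_1, ..., v_m is a function on nat of which only the values on {1..m} matter. *)

definition p_energy :: "nat \<Rightarrow> nat \<Rightarrow> (nat \<Rightarrow> complex ^ 'n) \<Rightarrow> real"
  where "p_energy p m v = (\<Sum>j\<in>{1..m}. \<Sum>i\<in>{1..<j}. cmod (hermitian (v i) (v j)) ^ p)"

definition p_energies :: "nat \<Rightarrow> nat \<Rightarrow> 'n::finite itself \<Rightarrow> real set"
  where "p_energies p m _ =
    {p_energy p m v | v :: nat \<Rightarrow> complex ^ 'n. \<forall>l\<in>{1..m}. norm (v l) = 1}"

(* M^p(m,n), with n = CARD('n); LEAST is a genuine minimum by min_p_energy_attained. *)

definition min_p_energy :: "nat \<Rightarrow> nat \<Rightarrow> 'n::finite itself \<Rightarrow> real"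
  where "min_p_energy p m N = (LEAST x. x \<in> p_energies p m N)"

lemma min_p_energy_attained:
  fixes N :: "'n::finite itself"
  shows "min_p_energy p m N \<in> p_energies p m N"
    and "x \<in> p_energies p m N \<Longrightarrow> min_p_energy p m N \<le> x"
proof -
  define S where "S = (UNIV :: nat set) \<rightarrow>\<^sub>E sphere (0 :: complex ^ 'n) 1"
  have "compactin (product_topology (\<lambda>i. euclidean) (UNIV :: nat set)) S"
    unfolding S_def by (subst compactin_PiE) simp
  then have cpt: "compact S"
    by (simp add: euclidean_product_topology)
  obtain u :: "complex ^ 'n" where u: "norm u = 1"
    using vector_choose_size[of 1] by auto
  have "(\<lambda>_. u) \<in> S"
    using u by (simp add: S_def PiE_iff)
  have coord: "continuous_on S (\<lambda>v. v i)" for i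
    by (rule continuous_on_subset[OF continuous_on_product_coordinates subset_UNIV])
  have cont: "continuous_on S (p_energy p m)"
    unfolding p_energy_def hermitian_def by (intro continuous_intros coord)
  obtain v where v: "v \<in> S" "\<And>w. w \<in> S \<Longrightarrow> p_energy p m v \<le> p_energy p m w"
    using continuous_attains_inf[OF cpt _ cont] \<open>(\<lambda>_. u) \<in> S\<close> by (metis empty_iff)
  have mem: "p_energy p m v \<in> p_energies p m N"
    using v(1) by (auto simp: p_energies_def S_def PiE_iff)
  have le: "p_energy p m v \<le> x" if x: "x \<in> p_energies p m N" for x
  proof -
    obtain w :: "nat \<Rightarrow> complex ^ 'n"
      where w: "x = p_energy p m w" "\<forall>l\<in>{1..m}. norm (w l) = 1"
      using x by (auto simp: p_energies_def)
    define w' where "w' = (\<lambda>l. if l \<in> {1..m} then w l else u)"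
    have "p_energy p m w' = p_energy p m w"
      unfolding p_energy_def by (intro sum.cong) (auto simp: w'_def)
    moreover have "w' \<in> S"
      using w(2) u by (auto simp: S_def w'_def PiE_iff)
    ultimately show ?thesis
      using v(2) w(1) by metis
  qed
  have "min_p_energy p m N = p_energy p m v"
    unfolding min_p_energy_def using mem le by (intro Least_equality)
  then show "min_p_energy p m N \<in> p_energies p m N"
    and "x \<in> p_energies p m N \<Longrightarrow> min_p_energy p m N \<le> x"
    using mem le by auto
qed

definition frame_potential :: "nat \<Rightarrow> (nat \<Rightarrow> real ^ 3) \<Rightarrow> real"
  where "frame_potential m w = (\<Sum>i\<in>{1..m}. \<Sum>j\<in>{1..m}. (w i \<bullet> w j)\<^sup>2)"

end

theory Submission
  imports Defs
begin

text \<open>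
  Both parts come down to the existence, for these \<open>m\<close>, of \<open>m\<close> unit vectors in \<open>\<real>\<^sup>3\<close> that have sum
  zero and form a tight frame, that is, whose second moment matrix
  \<open>S\<^sub>a\<^sub>b = (\<Sum>i. v\<^sub>i\<^sub>a v\<^sub>i\<^sub>b)\<close> equals \<open>m/3\<close> times the identity (a spherical 2-design).

  The frame potential is the squared Frobenius norm of \<open>S\<close> (\<open>frame_potential_Frobenius\<close>). As \<open>S\<close>
  has trace \<open>m\<close>, Cauchy-Schwarz on its diagonal gives the lower bound \<open>m\<^sup>2/3\<close>, which tight frames
  attain. This settles the first part once a balanced tight frame is known.

  The Bloch map sends unit vectors of \<open>\<complex>\<^sup>2\<close> onto the unit sphere of \<open>\<real>\<^sup>3\<close> in such a way that
  \<open>\<bar>\<langle>v,w\<rangle>\<bar>\<^sup>2 = (1 + x \<bullet> y)/2\<close> when \<open>v, w\<close> go to \<open>x, y\<close>. Squaring and summing over all pairs turns the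
  4-energy of the \<open>v\<^sub>i\<close> into an affine increasing function of \<open>2 \<bar>\<Sum>x\<^sub>i\<bar>\<^sup>2 + (frame potential of x)\<close>
  (\<open>p_energy_4_Bloch\<close>). Both terms are simultaneously smallest exactly at balanced tight frames, and
  the value there is \<open>m (m - 3)/6\<close>.

  To build the design, place a regular \<open>k\<close>-gon and a regular \<open>l\<close>-gon, \<open>k + l = m\<close>, in two parallel
  horizontal planes. A polygon with at least three vertices has the same first and second moments as
  a uniform circle, so only two equations for the heights \<open>a, b\<close> are left: \<open>k a + l b = 0\<close> and
  \<open>k a\<^sup>2 + l b\<^sup>2 = m/3\<close>. They are solved by \<open>a = sqrt (l/(3k))\<close> and \<open>b = - sqrt (k/(3l))\<close>, which are
  heights of points of the sphere provided \<open>l \<le> 3k\<close> and \<open>k \<le> 3l\<close>. Splitting \<open>m \<ge> 6\<close> into two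
  nearly equal halves satisfies everything. For \<open>m = 4\<close> the split \<open>1 + 3\<close> replaces the first
  polygon by the north pole and yields the regular tetrahedron.
\<close>

section \<open>The frame potential and its lower bound\<close>

text \<open>
  Expanding the square of the inner product and exchanging the sums over points and over coordinates
  exhibits the sum as the squared Frobenius norm of the second moment matrix.
\<close>

lemma frame_potential_Frobenius:
  fixes w :: "nat \<Rightarrow> real ^ 3"
  shows "frame_potential m w = (\<Sum>a\<in>UNIV. \<Sum>b\<in>UNIV. (\<Sum>i\<in>{1..m}. w i $ a * w i $ b)\<^sup>2)"
proof -
  have "frame_potential m w =
      (\<Sum>i\<in>{1..m}. \<Sum>j\<in>{1..m}. \<Sum>a\<in>UNIV. \<Sum>b\<in>UNIV. (w i $ a * w i $ b) * (w j $ a * w j $ b))"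
    unfolding frame_potential_def inner_vec_def power2_eq_square sum_product
    by (simp add: algebra_simps)
  also have "\<dots> = (\<Sum>a\<in>UNIV. \<Sum>b\<in>UNIV. \<Sum>i\<in>{1..m}. \<Sum>j\<in>{1..m}. (w i $ a * w i $ b) * (w j $ a * w j $ b))"
    by (simp only: sum.swap[of _ "UNIV :: 3 set" "{1..m}"])
  finally show ?thesis
    unfolding power2_eq_square sum_product .
qed

text \<open>
  The diagonal entries of the second moment matrix add up to \<open>m\<close>, so by Cauchy-Schwarz their squares
  alone already contribute \<open>m\<^sup>2/3\<close> to the Frobenius norm.
\<close>

lemma frame_potential_ge:
  fixes w :: "nat \<Rightarrow> real ^ 3"
  assumes "\<forall>i\<in>{1..m}. norm (w i) = 1"
  shows "(real m)\<^sup>2 / 3 \<le> frame_potential m w"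
proof -
  define S where "S a b = (\<Sum>i\<in>{1..m}. w i $ a * w i $ b)" for a b
  have "(\<Sum>a\<in>UNIV. S a a) = (\<Sum>i\<in>{1..m}. w i \<bullet> w i)"
    unfolding S_def inner_vec_def by (subst sum.swap) simp
  also have "\<dots> = real m"
    using assms by (simp add: dot_square_norm)
  finally have trace: "(\<Sum>a\<in>UNIV. S a a) = real m" .
  have "(real m)\<^sup>2 \<le> 3 * (\<Sum>a\<in>UNIV. (S a a)\<^sup>2)"
    using Cauchy_Schwarz_ineq_sum[of "\<lambda>_. 1" "\<lambda>a. S a a" "UNIV :: 3 set"] trace by simp
  also have "(\<Sum>a\<in>UNIV. (S a a)\<^sup>2) \<le> (\<Sum>a\<in>UNIV. \<Sum>b\<in>UNIV. (S a b)\<^sup>2)"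
    by (intro sum_mono member_le_sum) auto
  finally show ?thesis
    by (simp add: frame_potential_Frobenius S_def)
qed

section \<open>Balanced tight frames\<close>

definition balanced_tight_frame :: "nat \<Rightarrow> (nat \<Rightarrow> real ^ 3) \<Rightarrow> bool"
  where "balanced_tight_frame m v \<longleftrightarrow>
    (\<forall>i\<in>{1..m}. norm (v i) = 1) \<and> (\<Sum>i\<in>{1..m}. v i) = 0 \<and>
    (\<forall>a b. (\<Sum>i\<in>{1..m}. v i $ a * v i $ b) = (if a = b then real m / 3 else 0))"

lemma frame_potential_balanced_tight_frame:
  assumes "balanced_tight_frame m v"
  shows "frame_potential m v = (real m)\<^sup>2 / 3"
proof -
  have "frame_potential m v = (\<Sum>a\<in>(UNIV :: 3 set). \<Sum>b\<in>UNIV. if a = b then (real m / 3)\<^sup>2 else 0)"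
    unfolding frame_potential_Frobenius
    using assms by (intro sum.cong refl) (auto simp: balanced_tight_frame_def)
  then show ?thesis
    by (simp add: power2_eq_square)
qed

text \<open>
  The radius \<open>sqrt (1 - h\<^sup>2)\<close> is that of the circle of latitude of height \<open>h\<close>, so the polygon is inscribed
  in the unit sphere. For \<open>\<bar>h\<bar> = 1\<close> all its vertices coincide with a pole.
\<close>

definition polygon_vertex :: "nat \<Rightarrow> real \<Rightarrow> nat \<Rightarrow> real ^ 3"
  where "polygon_vertex k h j =
    vector [sqrt (1 - h\<^sup>2) * cos (2 * pi * j / k), sqrt (1 - h\<^sup>2) * sin (2 * pi * j / k), h]"

lemma norm_polygon_vertex:
  assumes "h\<^sup>2 \<le> 1"
  shows "norm (polygon_vertex k h j) = 1"
proof -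
  have "(norm (polygon_vertex k h j))\<^sup>2 = 1"
    using assms unfolding power2_norm_eq_inner
    by (simp add: inner_vec_def sum_3 polygon_vertex_def vector_3 power2_eq_square[symmetric]
        power_mult_distrib flip: distrib_left)
  then show ?thesis
    by (simp add: power2_eq_1_iff) (smt (verit) norm_ge_zero)
qed

text \<open>
  A geometric sum whose ratio is a root of unity. The ratio differs from 1 because the angle
  \<open>2 \<pi> r / k\<close> lies strictly between 0 and \<open>2 \<pi>\<close>.
\<close>

lemma sum_cis_roots_of_unity:
  fixes r k :: nat
  assumes "0 < r" "r < k"
  shows "(\<Sum>j\<in>{1..k}. cis (real j * (2 * pi * r / k))) = 0"
proof -
  define z where "z = cis (2 * pi * r / k)"
  have "real k * (2 * pi * r / k) = 2 * pi * r"
    using assms by simp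
  then have "z ^ k = cis (2 * pi * r)"
    by (simp only: z_def Complex.DeMoivre)
  also have "\<dots> = 1"
    by (metis cis_multiple_2pi Ints_of_nat mult.commute mult.left_commute)
  finally have one: "z ^ k = 1" .
  have "z \<noteq> 1"
  proof
    assume "z = 1"
    then have "cos (2 * pi * r / k) = 1"
      by (simp add: z_def complex_eq_iff)
    then obtain n :: int where "2 * pi * r / k = real_of_int n * 2 * pi"
      using cos_one_2pi_int by blast
    then have "real r = real_of_int n * real k"
      using assms by (simp add: field_simps)
    then have "int r = n * int k"
      by (metis of_int_eq_iff of_int_mult of_int_of_nat_eq)
    then show False
      using assms by (metis dvd_triv_right int_dvd_int_iff nat_dvd_not_less)
  qed
  have "(\<Sum>j\<in>{1..k}. cis (real j * (2 * pi * r / k))) = (\<Sum>j\<in>{1..k}. z ^ j)"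
    by (simp add: z_def Complex.DeMoivre)
  also have "\<dots> = z * (\<Sum>j<k. z ^ j)"
    by (simp add: sum_distrib_left sum.shift_bounds_Suc_ivl[symmetric] lessThan_atLeast0
        atLeastLessThanSuc_atLeastAtMost flip: power_Suc sum.atLeast_Suc_lessThan_Suc_shift)
  also have "\<dots> = 0"
    using \<open>z \<noteq> 1\<close> one by (simp add: geometric_sum)
  finally show ?thesis .
qed

text \<open>
  Up to order two, a polygon with three or more vertices has the moments of a uniform circle: the
  products of two coordinates involve the angle and its double, and both average to zero. A polygon
  that has shrunk to a pole satisfies the same formulas for any number of vertices.
\<close>

lemma polygon_moments:
  assumes "h\<^sup>2 \<le> 1" and "3 \<le> k \<or> h\<^sup>2 = 1"
  shows "(\<Sum>j\<in>{1..k}. polygon_vertex k h j) = vector [0, 0, k * h]" (is ?first)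
    and "(\<Sum>j\<in>{1..k}. polygon_vertex k h j $ a * polygon_vertex k h j $ b) =
      (if a \<noteq> b then 0 else if a = 3 then k * h\<^sup>2 else k * (1 - h\<^sup>2) / 2)" (is ?second)
proof -
  define s where "s = sqrt (1 - h\<^sup>2)"
  define t where "t j = 2 * pi * j / k" for j :: nat
  have s2: "s * s = 1 - h\<^sup>2"
    using assms(1) by (simp add: s_def)
  have v: "polygon_vertex k h j $ 1 = s * cos (t j)" "polygon_vertex k h j $ 2 = s * sin (t j)"
    "polygon_vertex k h j $ 3 = h" for j
    by (simp_all add: polygon_vertex_def s_def t_def vector_3)
  have trig: "s * (\<Sum>j\<in>{1..k}. cos (t j)) = 0" "s * (\<Sum>j\<in>{1..k}. sin (t j)) = 0"
    "s * (\<Sum>j\<in>{1..k}. cos (2 * t j)) = 0" "s * (\<Sum>j\<in>{1..k}. sin (2 * t j)) = 0"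
  proof -
    consider "s = 0" | "3 \<le> k"
      using assms(2) by (auto simp: s_def)
    then have "s * (\<Sum>j\<in>{1..k}. cos (t j)) = 0 \<and> s * (\<Sum>j\<in>{1..k}. sin (t j)) = 0 \<and>
      s * (\<Sum>j\<in>{1..k}. cos (2 * t j)) = 0 \<and> s * (\<Sum>j\<in>{1..k}. sin (2 * t j)) = 0"
    proof cases
      case 2
      have "(\<Sum>j\<in>{1..k}. cis (t j)) = 0" "(\<Sum>j\<in>{1..k}. cis (2 * t j)) = 0"
        using sum_cis_roots_of_unity[of 1 k] sum_cis_roots_of_unity[of 2 k] 2
        by (simp_all add: t_def mult_ac)
      then show ?thesis
        by (simp add: complex_eq_iff)
    qed simp
    then show "s * (\<Sum>j\<in>{1..k}. cos (t j)) = 0" "s * (\<Sum>j\<in>{1..k}. sin (t j)) = 0"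
      "s * (\<Sum>j\<in>{1..k}. cos (2 * t j)) = 0" "s * (\<Sum>j\<in>{1..k}. sin (2 * t j)) = 0"
      by auto
  qed
  show ?first
    using trig by (simp add: vec_eq_iff forall_3 v vector_3 flip: sum_distrib_left)
  have xx: "(\<Sum>j\<in>{1..k}. (s * cos (t j)) * (s * cos (t j))) = k * (1 - h\<^sup>2) / 2"
  proof -
    have "(s * cos (t j)) * (s * cos (t j)) = (1 - h\<^sup>2) / 2 + s / 2 * (s * cos (2 * t j))" for j
    proof -
      have "(s * cos (t j)) * (s * cos (t j)) = (s * s) / 2 + s / 2 * (s * cos (2 * t j))"
        unfolding cos_double_cos by (simp add: power2_eq_square field_simps)
      then show ?thesis
        by (simp add: s2)
    qed
    then show ?thesis
      using trig by (simp add: sum.distrib flip: sum_distrib_left sum_divide_distrib)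
  qed
  have yy: "(\<Sum>j\<in>{1..k}. (s * sin (t j)) * (s * sin (t j))) = k * (1 - h\<^sup>2) / 2"
  proof -
    have "(s * sin (t j)) * (s * sin (t j)) = (1 - h\<^sup>2) / 2 - s / 2 * (s * cos (2 * t j))" for j
    proof -
      have "(s * sin (t j)) * (s * sin (t j)) = (s * s) / 2 - s / 2 * (s * cos (2 * t j))"
        unfolding cos_double_sin by (simp add: power2_eq_square field_simps)
      then show ?thesis
        by (simp add: s2)
    qed
    then show ?thesis
      using trig by (simp add: sum_subtractf flip: sum_distrib_left sum_divide_distrib)
  qed
  have xy: "(\<Sum>j\<in>{1..k}. (s * cos (t j)) * (s * sin (t j))) = 0"
  proof -
    have eq: "(s * cos (t j)) * (s * sin (t j)) = s / 2 * (s * sin (2 * t j))" for j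
      by (simp add: sin_double)
    then show ?thesis
      unfolding eq sum_distrib_left[symmetric] using trig by simp
  qed
  have xz: "(\<Sum>j\<in>{1..k}. (s * cos (t j)) * h) = 0" "(\<Sum>j\<in>{1..k}. (s * sin (t j)) * h) = 0"
    using trig by (simp_all flip: sum_distrib_left sum_distrib_right)
  have "\<forall>a b. (\<Sum>j\<in>{1..k}. polygon_vertex k h j $ a * polygon_vertex k h j $ b) =
      (if a \<noteq> b then 0 else if a = 3 then k * h\<^sup>2 else k * (1 - h\<^sup>2) / 2)"
    using xx yy xy xz by (simp add: forall_3 v mult.commute power2_eq_square)
  then show ?second
    by blast
qed

text \<open>
  Two polygons at heights of opposite sign: the formulas for \<open>a\<close> and \<open>b\<close> solve the
  moment equations \<open>k a + l b = 0\<close> and \<open>k a\<^sup>2 + l b\<^sup>2 = (k + l)/3\<close>. The trace condition then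
  determines the two horizontal second moments. The alternative \<open>l = 3k\<close> means \<open>a = 1\<close>, so that the
  first polygon is the north pole.
\<close>

lemma balanced_tight_frame_two_polygons:
  fixes k l :: nat
  defines "a \<equiv> sqrt (l / (3 * k))" and "b \<equiv> - sqrt (k / (3 * l))"
  assumes pos: "0 < k" "0 < l" and le: "l \<le> 3 * k" "k \<le> 3 * l"
    and k3: "3 \<le> k \<or> l = 3 * k" and l3: "3 \<le> l"
  shows "balanced_tight_frame (k + l)
    (\<lambda>i. if i \<le> k then polygon_vertex k a i else polygon_vertex l b (i - k))"
proof -
  define v where "v = (\<lambda>i. if i \<le> k then polygon_vertex k a i else polygon_vertex l b (i - k))"
  have a2: "a\<^sup>2 = l / (3 * k)" and b2: "b\<^sup>2 = k / (3 * l)"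
    by (simp_all add: a_def b_def)
  have a1: "a\<^sup>2 \<le> 1" and b1: "b\<^sup>2 \<le> 1"
    using pos le unfolding a2 b2 by (simp_all add: divide_simps)
  have ak: "3 \<le> k \<or> a\<^sup>2 = 1"
    using k3 pos unfolding a2 by auto
  have height: "k * a + l * b = 0"
  proof -
    have weight: "real p * sqrt (q / (3 * p)) = sqrt (p * q / 3)" if "0 < p" for p q :: nat
    proof -
      have "sqrt (p * q / 3) = sqrt ((real p)\<^sup>2 * (q / (3 * p)))"
        using that by (simp add: power2_eq_square field_simps)
      then show ?thesis
        by (simp only: real_sqrt_mult) simp
    qed
    show ?thesis
      using weight[of k l] weight[of l k] pos by (simp add: a_def b_def mult.commute)
  qed
  have split: "(\<Sum>i\<in>{1..k + l}. f (v i)) =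
      (\<Sum>i\<in>{1..k}. f (polygon_vertex k a i)) + (\<Sum>i\<in>{1..l}. f (polygon_vertex l b i))"
    for f :: "real ^ 3 \<Rightarrow> 'c :: comm_monoid_add"
  proof -
    have "(\<Sum>i\<in>{1..k + l}. f (v i)) = (\<Sum>i\<in>{1..k}. f (v i)) + (\<Sum>i\<in>{k + 1..k + l}. f (v i))"
      by (rule sum.ub_add_nat) simp
    also have "(\<Sum>i\<in>{k + 1..k + l}. f (v i)) = (\<Sum>i\<in>{1..l}. f (v (i + k)))"
      using sum.shift_bounds_cl_nat_ivl[of "\<lambda>i. f (v i)" 1 k l] by (simp add: add.commute)
    finally show ?thesis
      by (simp add: v_def)
  qed
  have unit: "\<forall>i\<in>{1..k + l}. norm (v i) = 1"
    using a1 b1 by (simp add: v_def norm_polygon_vertex)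
  have zero: "(\<Sum>i\<in>{1..k + l}. v i) = 0"
    unfolding split[of "\<lambda>x. x"] polygon_moments(1)[OF a1 ak] polygon_moments(1)[OF b1 disjI1[OF l3]]
    using height by (simp add: vec_eq_iff forall_3 vector_3)
  have second: "(\<Sum>i\<in>{1..k + l}. v i $ c * v i $ d) = (if c = d then real (k + l) / 3 else 0)"
    for c d
    unfolding split[of "\<lambda>x. x $ c * x $ d"] polygon_moments(2)[OF a1 ak]
      polygon_moments(2)[OF b1 disjI1[OF l3]]
    using pos by (simp add: a2 b2 field_simps)
  show ?thesis
    using unit zero second unfolding balanced_tight_frame_def v_def by blast
qed

lemma exists_balanced_tight_frame:
  assumes "6 \<le> m \<or> m = 4"
  shows "\<exists>v. balanced_tight_frame m v"
proof (cases "m = 4")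
  case True
  then show ?thesis
    using balanced_tight_frame_two_polygons[of 1 3] by auto
next
  case False
  define k where "k = m div 2"
  define l where "l = m - k"
  have "3 \<le> k" "3 \<le> l" "l \<le> 3 * k" "k \<le> 3 * l" "m = k + l"
    using assms False unfolding k_def l_def by linarith+
  then show ?thesis
    using balanced_tight_frame_two_polygons[of k l] by auto
qed

section \<open>The Bloch map\<close>

definition Bloch :: "complex ^ 2 \<Rightarrow> real ^ 3"
  where "Bloch v = vector [2 * Re (v $ 1 * cnj (v $ 2)), 2 * Im (v $ 1 * cnj (v $ 2)),
    (cmod (v $ 1))\<^sup>2 - (cmod (v $ 2))\<^sup>2]"

lemma norm_complex_2: "(norm (v :: complex ^ 2))\<^sup>2 = (cmod (v $ 1))\<^sup>2 + (cmod (v $ 2))\<^sup>2"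
  by (simp add: norm_vec_def L2_set_def sum_2)

text \<open>
  Up to the sign of its second coordinate, the Bloch vector holds the coefficients of the rank one
  matrix \<open>2 v v\<^sup>*\<close> at the three Pauli matrices, and \<open>(norm v)\<^sup>2\<close> is the coefficient at the identity.
  These four matrices are orthogonal for the trace, and both sides are twice the trace of
  \<open>v v\<^sup>* w w\<^sup>*\<close>.
\<close>

lemma hermitian_Bloch:
  "2 * (cmod (hermitian v w))\<^sup>2 = (norm v)\<^sup>2 * (norm w)\<^sup>2 + Bloch v \<bullet> Bloch w"
  unfolding norm_complex_2
  by (simp add: hermitian_def Bloch_def inner_vec_def sum_2 sum_3 vector_3 cmod_power2)
    algebra

lemma norm_Bloch:
  assumes "norm v = 1"
  shows "norm (Bloch v) = 1"
proof -
  have "cmod (hermitian v v) = 1"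
    using assms by (simp add: norm_eq_sqrt_hermitian(1))
  then have "Bloch v \<bullet> Bloch v = 1"
    using hermitian_Bloch[of v v] assms by simp
  then show ?thesis
    by (simp add: norm_eq_sqrt_inner)
qed

text \<open>
  In spherical coordinates with polar angle \<open>u\<close> and azimuth \<open>t\<close>, a preimage is
  \<open>(cos (u/2), exp (- \<i> t) sin (u/2))\<close>. Writing the half-angle functions as square roots of
  \<open>(1 \<plusminus> z)/2\<close> covers the poles, where \<open>t\<close> is arbitrary, without a case distinction.
\<close>

lemma Bloch_surj:
  fixes x :: "real ^ 3"
  assumes "norm x = 1"
  obtains v where "norm v = 1" "Bloch v = x"
proof -
  define z where "z = x $ 3"
  have sq: "(x $ 1)\<^sup>2 + (x $ 2)\<^sup>2 = 1 - z\<^sup>2"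
  proof -
    have "x \<bullet> x = 1"
      using assms by (simp add: dot_square_norm)
    then show ?thesis
      by (simp add: inner_vec_def sum_3 z_def power2_eq_square)
  qed
  then have "z\<^sup>2 \<le> 1"
    by (smt (verit) zero_le_power2)
  then have z: "-1 \<le> z" "z \<le> 1"
    by (auto simp: abs_le_iff abs_square_le_1)
  define t where "t = Arg (Complex (x $ 1) (x $ 2))"
  have "Complex (x $ 1) (x $ 2) = rcis (sqrt (1 - z\<^sup>2)) t"
    using rcis_cmod_Arg[of "Complex (x $ 1) (x $ 2)"] sq by (simp add: t_def cmod_def)
  then have polar: "x $ 1 = sqrt (1 - z\<^sup>2) * cos t" "x $ 2 = sqrt (1 - z\<^sup>2) * sin t"
    by (simp_all add: complex_eq_iff)
  define v :: "complex ^ 2" where "v = vector [of_real (sqrt ((1 + z) / 2)),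
    of_real (sqrt ((1 - z) / 2)) * cnj (cis t)]"
  have v1: "v $ 1 = of_real (sqrt ((1 + z) / 2))"
    and v2: "v $ 2 = of_real (sqrt ((1 - z) / 2)) * cnj (cis t)"
    by (simp_all add: v_def)
  have n: "(cmod (v $ 1))\<^sup>2 = (1 + z) / 2" "(cmod (v $ 2))\<^sup>2 = (1 - z) / 2"
    using z by (simp_all add: v1 v2 norm_mult power_mult_distrib)
  have "sqrt ((1 + z) / 2) * sqrt ((1 - z) / 2) = sqrt ((1 - z\<^sup>2) / 2\<^sup>2)"
    by (simp add: power2_eq_square algebra_simps flip: real_sqrt_mult)
  also have "\<dots> = sqrt (1 - z\<^sup>2) / 2"
    by (simp add: real_sqrt_divide)
  finally have r: "sqrt ((1 + z) / 2) * sqrt ((1 - z) / 2) = sqrt (1 - z\<^sup>2) / 2" .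
  have prod: "v $ 1 * cnj (v $ 2) = of_real (sqrt (1 - z\<^sup>2) / 2) * cis t"
    unfolding r[symmetric] by (simp add: v1 v2)
  have "Bloch v = x"
    unfolding Bloch_def prod n using polar
    by (simp add: vec_eq_iff forall_3 vector_3 z_def field_simps)
  moreover have "norm v = 1"
  proof -
    have "(norm v)\<^sup>2 = 1\<^sup>2"
      unfolding norm_complex_2 n by (simp add: field_simps)
    then show ?thesis
      by (subst (asm) power2_eq_iff_nonneg) auto
  qed
  ultimately show ?thesis
    using that by blast
qed

section \<open>The minimal 4-energy\<close>

lemma sum_square_symmetric:
  fixes f :: "nat \<Rightarrow> nat \<Rightarrow> real"
  assumes "\<And>i j. f i j = f j i"
  shows "(\<Sum>i\<in>{1..m}. \<Sum>j\<in>{1..m}. f i j) = (\<Sum>i\<in>{1..m}. f i i) + 2 * (\<Sum>j\<in>{1..m}. \<Sum>i\<in>{1..<j}. f i j)"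
proof (induction m)
  case (Suc m)
  have "(\<Sum>j\<in>{1..m}. f (Suc m) j) = (\<Sum>i\<in>{1..m}. f i (Suc m))"
    using assms by simp
  then show ?case
    using Suc.IH by (simp add: sum.distrib atLeastLessThanSuc_atLeastAtMost)
qed simp

text \<open>
  The double sum over all ordered pairs of \<open>\<bar>\<langle>v\<^sub>i,v\<^sub>j\<rangle>\<bar>\<^sup>4 = (1 + x\<^sub>i \<bullet> x\<^sub>j)\<^sup>2/4\<close> expands into the three terms in
  the numerator. Passing to pairs \<open>i < j\<close> halves it after removing the \<open>m\<close> diagonal terms, each
  equal to 1.
\<close>

lemma p_energy_4_Bloch:
  fixes v :: "nat \<Rightarrow> complex ^ 2"
  assumes unit: "\<forall>l\<in>{1..m}. norm (v l) = 1"
  defines "x \<equiv> \<lambda>i. Bloch (v i)"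
  shows "p_energy 4 m v =
    ((real m)\<^sup>2 + 2 * (norm (\<Sum>i\<in>{1..m}. x i))\<^sup>2 + frame_potential m x) / 8 - real m / 2"
proof -
  define f where "f i j = cmod (hermitian (v i) (v j)) ^ 4" for i j
  have f: "4 * f i j = 1 + 2 * (x i \<bullet> x j) + (x i \<bullet> x j)\<^sup>2" if "i \<in> {1..m}" "j \<in> {1..m}" for i j
  proof -
    have "4 * f i j = (2 * (cmod (hermitian (v i) (v j)))\<^sup>2)\<^sup>2"
      by (simp add: f_def power_mult_distrib flip: power_mult)
    also have "2 * (cmod (hermitian (v i) (v j)))\<^sup>2 = 1 + x i \<bullet> x j"
      using unit that by (simp add: hermitian_Bloch x_def)
    finally show ?thesis
      by (simp add: power2_eq_square algebra_simps)
  qed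
  have diag: "f i i = 1" if "i \<in> {1..m}" for i
    using unit that by (simp add: f_def norm_eq_sqrt_hermitian(1))
  have sym: "f i j = f j i" for i j
  proof -
    have "hermitian (v j) (v i) = cnj (hermitian (v i) (v j))"
      by (simp add: hermitian_def mult.commute)
    then show ?thesis
      by (simp add: f_def)
  qed
  have "4 * (\<Sum>i\<in>{1..m}. \<Sum>j\<in>{1..m}. f i j) =
      (\<Sum>i\<in>{1..m}. \<Sum>j\<in>{1..m}. 1 + 2 * (x i \<bullet> x j) + (x i \<bullet> x j)\<^sup>2)"
    unfolding sum_distrib_left by (intro sum.cong refl f)
  also have "\<dots> = (real m)\<^sup>2 + 2 * (\<Sum>i\<in>{1..m}. \<Sum>j\<in>{1..m}. x i \<bullet> x j) + frame_potential m x"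
    by (simp add: sum.distrib frame_potential_def power2_eq_square flip: sum_distrib_left)
  also have "(\<Sum>i\<in>{1..m}. \<Sum>j\<in>{1..m}. x i \<bullet> x j) = (norm (\<Sum>i\<in>{1..m}. x i))\<^sup>2"
    unfolding power2_norm_eq_inner inner_sum_left inner_sum_right by (rule sum.swap)
  finally have "4 * (real m + 2 * p_energy 4 m v) =
      (real m)\<^sup>2 + 2 * (norm (\<Sum>i\<in>{1..m}. x i))\<^sup>2 + frame_potential m x"
    using sum_square_symmetric[of f m, OF sym] diag by (simp add: p_energy_def f_def)
  then show ?thesis
    by argo
qed

theorem theorem6:
  fixes m :: nat
  assumes "m \<ge> 6 \<or> m = 4"
  shows "(\<exists>v :: nat \<Rightarrow> real ^ 3.
            (\<forall>i\<in>{1..m}. v i \<in> sphere 0 1) \<and>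
            (\<Sum>i\<in>{1..m}. v i) = 0 \<and>
            (\<forall>w :: nat \<Rightarrow> real ^ 3. (\<forall>i\<in>{1..m}. w i \<in> sphere 0 1) \<longrightarrow>
                frame_potential m v \<le> frame_potential m w))
       \<and> min_p_energy 4 m TYPE(2) = real m * (real m - 3) / 6"
proof
  obtain x where x: "balanced_tight_frame m x"
    using exists_balanced_tight_frame assms by blast
  have unit: "\<forall>i\<in>{1..m}. norm (x i) = 1" and zero: "(\<Sum>i\<in>{1..m}. x i) = 0"
    using x by (simp_all add: balanced_tight_frame_def)
  note potential = frame_potential_balanced_tight_frame[OF x]
  have minimal: "frame_potential m x \<le> frame_potential m w" if "\<forall>i\<in>{1..m}. norm (w i) = 1" for w
    using frame_potential_ge[OF that] potential by simp
  show "\<exists>v :: nat \<Rightarrow> real ^ 3.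
            (\<forall>i\<in>{1..m}. v i \<in> sphere 0 1) \<and>
            (\<Sum>i\<in>{1..m}. v i) = 0 \<and>
            (\<forall>w :: nat \<Rightarrow> real ^ 3. (\<forall>i\<in>{1..m}. w i \<in> sphere 0 1) \<longrightarrow>
                frame_potential m v \<le> frame_potential m w)"
    using unit zero minimal by (intro exI[of _ x]) simp
  have "\<forall>i\<in>{1..m}. \<exists>u. norm u = 1 \<and> Bloch u = x i"
    using unit Bloch_surj by metis
  then obtain v where v: "\<forall>i\<in>{1..m}. norm (v i) = 1" "\<forall>i\<in>{1..m}. Bloch (v i) = x i"
    by metis
  have "(\<Sum>i\<in>{1..m}. Bloch (v i)) = 0"
    using v(2) zero by simp
  moreover have "frame_potential m (\<lambda>i. Bloch (v i)) = (real m)\<^sup>2 / 3"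
    using v(2) potential by (simp add: frame_potential_def)
  ultimately have "p_energy 4 m v = real m * (real m - 3) / 6"
    by (simp add: p_energy_4_Bloch[OF v(1)] power2_eq_square field_simps)
  then have mem: "real m * (real m - 3) / 6 \<in> p_energies 4 m TYPE(2)"
    using v(1) unfolding p_energies_def by force
  have lower: "real m * (real m - 3) / 6 \<le> e" if e: "e \<in> p_energies 4 m TYPE(2)" for e
  proof -
    obtain w :: "nat \<Rightarrow> complex ^ 2" where w: "e = p_energy 4 m w" "\<forall>l\<in>{1..m}. norm (w l) = 1"
      using e by (auto simp: p_energies_def)
    have "(real m)\<^sup>2 / 3 \<le> frame_potential m (\<lambda>i. Bloch (w i))"
      using w(2) by (intro frame_potential_ge) (simp add: norm_Bloch)
    moreover have "0 \<le> (norm (\<Sum>i\<in>{1..m}. Bloch (w i)))\<^sup>2"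
      by simp
    moreover have "real m * (real m - 3) / 6 = ((real m)\<^sup>2 + (real m)\<^sup>2 / 3) / 8 - real m / 2"
      by (simp add: power2_eq_square field_simps)
    ultimately show ?thesis
      unfolding w(1) p_energy_4_Bloch[OF w(2)] by argo
  qed
  show "min_p_energy 4 m TYPE(2) = real m * (real m - 3) / 6"
    unfolding min_p_energy_def using mem lower by (intro Least_equality)
qed

end
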